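(* Let $n\geq 0$ be an integer. Then \[ CP_{(2,1)}(n) = \frac{1}{(q;q)_{2n}} \sum_{r=-\infty}^\infty (-1)^r q^{r(5r+1)/2} {2n \brack n-\frac{5r}{2} + \frac{(-1)^r-1}{4}}_q, \] \[ CP_{(3,0)}(n) = \frac{1}{(q;q)_{2n}} \sum_{r=-\infty}^\infty (-1)^r q^{r(5r+3)/2} {2n \brack n-\frac{5r}{2} + 3\frac{(-1)^r-1}{4}}_q. \]
   Context: $(a;q)_m=\prod_{j=0}^{m-1}(1-aq^j)$. For integers $a,b$, the $q$-binomial coefficient is ${a\brack b}_q=\frac{(q;q)_a}{(q;q)_b(q;q)_{a-b}}$ if $0\le b\le a$ and $0$ otherwise. A cylindric partition with profile $(c_1,c_2)$ (nonnegative integers) is a pair of integer partitions $(\lambda^{(1)},\lambda^{(2)})$ (parts written in weakly decreasing order $\lambda^{(i)}_1\ge\lambda^{(i)}_2\ge\cdots$, with $\lambda^{(i)}_j=0$ beyond the number of parts) such that $\lambda^{(1)}_j\ge\lambda^{(2)}_{j+c_2}$ and $\lambda^{(2)}_j\ge\lambda^{(1)}_{j+c_1}$ for all $j\ge1$. Its size is $|\lambda^{(1)}|+|\lambda^{(2)}|$. For integers $a\ge b\ge0$ and $n\ge0$, $CP_{(a,b)}(n)$ denotes the generating function $\sum q^{\text{size}}$ over cylindric partitions with profile $(a,b)$ in which each of the two partitions has at most $n$ parts; $CP_{(a,b)}(0)=1$. *)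

theory Defs
  imports
    "HOL-Computational_Algebra.Formal_Power_Series"
    "HOL-Analysis.Infinite_Sum"
begin

definition qpoch :: "'a::comm_ring_1 \<Rightarrow> 'a \<Rightarrow> nat \<Rightarrow> 'a" where
  "qpoch a q m = (\<Prod>j<m. 1 - a * q ^ j)"

text \<open>Here \<open>q\<close> is the formal variable. All divisors have constant coefficient 1, so that \<open>/\<close>
  is multiplication by the inverse power series.\<close>

definition qbinom :: "int \<Rightarrow> int \<Rightarrow> rat fps" where
  "qbinom a b =
     (if 0 \<le> b \<and> b \<le> a
      then qpoch fps_X fps_X (nat a) /
             (qpoch fps_X fps_X (nat b) * qpoch fps_X fps_X (nat (a - b)))
      else 0)"

lemma qpoch_nth_0: "fps_nth (qpoch fps_X fps_X m :: rat fps) 0 = 1"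
  by (induction m) (simp_all add: qpoch_def)

text \<open>An integer partition is the weakly decreasing list of its (positive) parts.\<close>

definition int_partition :: "nat list \<Rightarrow> bool" where
  "int_partition xs \<longleftrightarrow> sorted_wrt (\<ge>) xs \<and> (\<forall>x\<in>set xs. 0 < x)"

text \<open>Parts are numbered from 1.\<close>

definition part :: "nat list \<Rightarrow> nat \<Rightarrow> nat" where
  "part xs j = (if 1 \<le> j \<and> j \<le> length xs then xs ! (j - 1) else 0)"

definition cylindric_partition :: "nat \<times> nat \<Rightarrow> nat list \<times> nat list \<Rightarrow> bool" where
  "cylindric_partition = (\<lambda>(c1, c2) (xs, ys).
     int_partition xs \<and> int_partition ys \<and>
     (\<forall>j\<ge>1. part xs j \<ge> part ys (j + c2)) \<and>
     (\<forall>j\<ge>1. part ys j \<ge> part xs (j + c1)))"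

definition cp_size :: "nat list \<times> nat list \<Rightarrow> nat" where
  "cp_size = (\<lambda>(xs, ys). sum_list xs + sum_list ys)"

definition cp_set :: "nat \<times> nat \<Rightarrow> nat \<Rightarrow> nat \<Rightarrow> (nat list \<times> nat list) set" where
  "cp_set c n k = {(xs, ys). cylindric_partition c (xs, ys) \<and>
     length xs \<le> n \<and> length ys \<le> n \<and> cp_size (xs, ys) = k}"

definition CP :: "nat \<times> nat \<Rightarrow> nat \<Rightarrow> rat fps" where
  "CP c n = Abs_fps (\<lambda>k. of_nat (card (cp_set c n k)))"

lemma finite_cp_set: "finite (cp_set c n k)"
proof -
  let ?L = "{xs. set xs \<subseteq> {..k} \<and> length xs \<le> n}"
  have "cp_set c n k \<subseteq> ?L \<times> ?L"
    by (auto simp: cp_set_def cp_size_def dest!: member_le_sum_list)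
  moreover have "finite (?L \<times> ?L)"
    by (intro finite_cartesian_product finite_lists_length_le) auto
  ultimately show ?thesis
    by (rule finite_subset)
qed

lemma CP_0: "CP c 0 = 1"
proof -
  have "cp_set c 0 k = (if k = 0 then {([], [])} else {})" for k
    by (cases c)
      (auto simp: cp_set_def cp_size_def cylindric_partition_def int_partition_def part_def)
  then show ?thesis
    by (auto simp: CP_def fps_eq_iff)
qed

text \<open>The lower indices \<open>n - 5r/2 + c ((-1)^r - 1)/4\<close> (with \<open>c = 1\<close> or \<open>c = 3\<close>) of the
  \<open>q\<close>-binomial coefficients in the theorem are integers; the floor function merely converts
  them from \<open>rat\<close> to \<open>int\<close>.\<close>

lemma lower_index_in_Ints:
  fixes c r :: int
  assumes "odd c"
  shows "(of_nat n - 5 * of_int r / 2 + of_int c * (((-1) powi r - 1) / 4) :: rat) \<in> \<int>"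
proof (cases "even r")
  case True
  then obtain s where "r = 2 * s" by (elim evenE)
  then show ?thesis
    by (simp add: power_int_minus_left)
next
  case False
  then obtain s where s: "r = 2 * s + 1" by (elim oddE)
  obtain d where d: "c = 2 * d + 1" using assms by (elim oddE)
  have "(-1 :: rat) powi r = -1" using False by (simp add: power_int_minus_left)
  then have "(of_nat n - 5 * of_int r / 2 + of_int c * (((-1) powi r - 1) / 4) :: rat) =
      of_int (int n - 5 * s - 3 - d)"
    by (simp add: s d field_simps)
  then show ?thesis by (metis Ints_of_int)
qed

text \<open>Likewise, the exponents \<open>r (5 r + c) / 2\<close> of \<open>q\<close> are nonnegative integers.\<close>

lemma q_exponent_exact:
  fixes c r :: int
  assumes "odd c" "\<bar>c\<bar> \<le> 5"
  shows "2 * int (nat (r * (5 * r + c) div 2)) = r * (5 * r + c)"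
proof -
  have "even (r * (5 * r + c))" using assms by auto
  moreover have "0 \<le> r * (5 * r + c)"
  proof -
    consider "r = 0" | "r \<ge> 1" | "r \<le> -1" by linarith
    then show ?thesis
      using assms(2) by cases (auto intro!: mult_nonneg_nonneg mult_nonpos_nonpos)
  qed
  ultimately show ?thesis by simp
qed

text \<open>The bilateral sums in the theorem are infinite sums with respect to the \<open>X\<close>-adic
  topology on formal power series. Only finitely many terms are nonzero, so the sums exist.\<close>

lemma summable_qbinom:
  fixes c :: int and f :: "int \<Rightarrow> rat fps"
  assumes "odd c"
  shows "(\<lambda>r::int. f r * qbinom (2 * int n)
    \<lfloor>of_nat n - 5 * of_int r / 2 + of_int c * (((-1) powi r - 1) / 4) :: rat\<rfloor>) summable_on UNIV"
proof -
  let ?i = "\<lambda>r::int. of_nat n - 5 * of_int r / 2 + of_int c * (((-1) powi r - 1) / 4) :: rat"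
  let ?N = "2 * int n + \<bar>c\<bar> + 1"
  have "qbinom (2 * int n) \<lfloor>?i r\<rfloor> = 0" if r: "r \<notin> {- ?N..?N}" for r
  proof -
    obtain m where m: "?i r = of_int m"
      using lower_index_in_Ints[OF assms, of n r] by (rule Ints_cases)
    have "of_int (4 * m) = 4 * ?i r"
      unfolding m by simp
    also have "\<dots> = of_int (4 * int n - 10 * r + c * (if even r then 0 else -2))"
      by (cases "even r") (simp_all add: power_int_minus_left)
    finally have "4 * m = 4 * int n - 10 * r + c * (if even r then 0 else -2)"
      by (simp only: of_int_eq_iff)
    with r have "\<not> (0 \<le> m \<and> m \<le> 2 * int n)"
      by (auto split: if_splits)
    moreover have "\<lfloor>?i r\<rfloor> = m"
      unfolding m by (rule floor_of_int)
    ultimately show ?thesis by (simp only: qbinom_def if_False)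
  qed
  then have "(\<lambda>r. f r * qbinom (2 * int n) \<lfloor>?i r\<rfloor>) summable_on UNIV \<longleftrightarrow>
      (\<lambda>r. f r * qbinom (2 * int n) \<lfloor>?i r\<rfloor>) summable_on {- ?N..?N}"
    by (intro summable_on_cong_neutral) (simp_all only: mult_zero_right Diff_iff UNIV_I not_True_eq_False simp_thms)
  moreover have "(\<lambda>r. f r * qbinom (2 * int n) \<lfloor>?i r\<rfloor>) summable_on {- ?N..?N}"
    by (rule summable_on_finite) (rule finite_atLeastAtMost_int)
  ultimately show ?thesis by (rule iffD2)
qed

end

theory Submission
  imports Defs "HOL-Library.Groups_Big_Fun"
begin

text \<open>Let \<open>F(a, b)\<close> be the generating function of the cylindric partitions of profile \<open>(c, d)\<close>
  whose two components have at most \<open>a\<close> and \<open>b\<close> parts. Removing the first column from both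
  components and inclusion-exclusion give
  \<open>F(a, b) - F(a-1, b) - F(a, b-1) + F(a-1, b-1) = q^(a+b) F(a, b)\<close> in the strip
  \<open>-d \<le> a - b \<le> c\<close>, while \<open>F(a, b) = F(a-1, b)\<close> for \<open>a - b = c + 1\<close> and
  \<open>F(a, b) = F(a, b-1)\<close> for \<open>b - a = d + 1\<close>, since the interlacing conditions forbid \<open>(a, b)\<close> as
  pair of lengths there. These relations determine \<open>F\<close>. The product \<open>1/((q)_a (q)_b)\<close> solves the
  recurrence, and so do its translates along \<open>a + b\<close> constant; by the reflection principle an
  alternating sum, weighted by powers of \<open>q\<close>, over the images of \<open>(a, b)\<close> under the group
  generated by the reflections in the two boundary lines satisfies the boundary conditions as well. At \<open>a = b = n\<close> this sum is the
  one in the theorem, with \<open>5\<close> replaced by \<open>c + d + 2\<close>.\<close>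

section \<open>Sums with finite support\<close>

lemma finite_support_diff:
  fixes f g :: "'b \<Rightarrow> 'a::group_add"
  assumes "finite {x. f x \<noteq> 0}" "finite {x. g x \<noteq> 0}"
  shows "finite {x. f x - g x \<noteq> 0}"
  by (rule finite_subset [OF _ finite_UnI [OF assms]]) auto

lemma Sum_any_diff:
  fixes f g :: "'b \<Rightarrow> 'a::ab_group_add"
  assumes "finite {x. f x \<noteq> 0}" "finite {x. g x \<noteq> 0}"
  shows "Sum_any (\<lambda>x. f x - g x) = Sum_any f - Sum_any g"
  using Sum_any.distrib [OF finite_support_diff [OF assms] assms(2)] by simp

lemma Sum_any_eq_0_involution:
  fixes f :: "'b \<Rightarrow> 'a::{idom, semiring_char_0}"
  assumes involution: "\<And>x. p (p x) = x" and odd: "\<And>x. f (p x) = - f x"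
  shows "Sum_any f = 0"
proof -
  have "bij p"
    using involution by (rule involuntory_imp_bij)
  then have "Sum_any f = Sum_any (\<lambda>x. - f x)"
    by (rule Sum_any.reindex_cong) (simp add: fun_eq_iff odd)
  also have "\<dots> = - Sum_any f"
    by (simp add: Sum_any.expand_set sum_negf)
  finally have "2 * Sum_any f = 0"
    by (metis add.right_inverse mult_2)
  then show ?thesis by simp
qed

lemma infsum_eq_Sum_any:
  fixes f :: "'b \<Rightarrow> 'a::{comm_monoid_add, t2_space}"
  assumes "finite {x. f x \<noteq> 0}"
  shows "infsum f UNIV = Sum_any f"
proof -
  have "infsum f UNIV = infsum f {x. f x \<noteq> 0}"
    by (rule infsum_cong_neutral) auto
  with assms show ?thesis by (simp add: Sum_any.expand_set)
qed

section \<open>The recurrence on the strip\<close>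

locale strip_recurrence =
  fixes c d :: nat and F :: "int \<Rightarrow> int \<Rightarrow> 'a::idom fps"
  assumes origin: "F 0 0 = 1"
    and outside_quadrant:
      "a < 0 \<or> b < 0 \<Longrightarrow> a - b \<le> int c + 1 \<Longrightarrow> b - a \<le> int d + 1 \<Longrightarrow> F a b = 0"
    and upper_boundary: "a = b + int c + 1 \<Longrightarrow> F a b = F (a - 1) b"
    and lower_boundary: "b = a + int d + 1 \<Longrightarrow> F a b = F a (b - 1)"
    and interior:
      "0 \<le> a \<Longrightarrow> 0 \<le> b \<Longrightarrow> a - b \<le> int c \<Longrightarrow> b - a \<le> int d \<Longrightarrow>
        F a b - F (a - 1) b - F a (b - 1) + F (a - 1) (b - 1) = fps_X ^ nat (a + b) * F a b"

lemma (in strip_recurrence) interior_eq: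
  assumes "0 \<le> a" "0 \<le> b" "a - b \<le> int c" "b - a \<le> int d"
  shows "(1 - fps_X ^ nat (a + b)) * F a b = F (a - 1) b + F a (b - 1) - F (a - 1) (b - 1)"
  using interior [OF assms] by (simp add: algebra_simps)

lemma fps_X_power_eq_1_iff: "fps_X ^ m = (1 :: 'a::comm_ring_1 fps) \<longleftrightarrow> m = 0"
  by (auto simp: fps_eq_iff)

theorem strip_recurrence_unique:
  assumes "strip_recurrence c d F" "strip_recurrence c d G"
    and "a - b \<le> int c + 1" "b - a \<le> int d + 1"
  shows "F a b = G a b"
  using assms(3,4)
proof (induction "nat (a + b + 1)" arbitrary: a b rule: less_induct)
  case (less a b)
  interpret F: strip_recurrence c d F by fact
  interpret G: strip_recurrence c d G by fact
  consider (outside) "a < 0 \<or> b < 0" | (origin) "a = 0" "b = 0"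
    | (upper) "a \<ge> 0" "b \<ge> 0" "a = b + int c + 1"
    | (lower) "a \<ge> 0" "b \<ge> 0" "b = a + int d + 1"
    | (interior) "a \<ge> 0" "b \<ge> 0" "a + b > 0" "a - b \<le> int c" "b - a \<le> int d"
    using less.prems by linarith
  then show ?case
  proof cases
    case outside
    with less.prems show ?thesis by (simp add: F.outside_quadrant G.outside_quadrant)
  next
    case origin
    then show ?thesis by (simp add: F.origin G.origin)
  next
    case upper
    then have "F (a - 1) b = G (a - 1) b"
      by (intro less.hyps) auto
    with upper show ?thesis
      by (metis F.upper_boundary G.upper_boundary)
  next
    case lower
    then have "F a (b - 1) = G a (b - 1)"
      by (intro less.hyps) auto
    with lower show ?thesis
      by (metis F.lower_boundary G.lower_boundary)
  next
    case interior
    then have "F (a - 1) b = G (a - 1) b" "F a (b - 1) = G a (b - 1)"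
      "F (a - 1) (b - 1) = G (a - 1) (b - 1)"
      by (auto intro!: less.hyps)
    with interior have "(1 - fps_X ^ nat (a + b)) * F a b = (1 - fps_X ^ nat (a + b)) * G a b"
      by (simp add: F.interior_eq G.interior_eq)
    with interior show ?thesis
      by (simp add: fps_X_power_eq_1_iff)
  qed
qed

section \<open>Reciprocals of \<open>q\<close>-factorials\<close>

text \<open>The value \<open>0\<close> at negative arguments makes the recurrences below hold for all integers.\<close>

definition inv_qpoch :: "int \<Rightarrow> 'a::field fps" where
  "inv_qpoch m = (if m < 0 then 0 else inverse (qpoch fps_X fps_X (nat m)))"

lemma inv_qpoch_neg [simp]: "m < 0 \<Longrightarrow> inv_qpoch m = 0"
  by (simp add: inv_qpoch_def)

lemma inv_qpoch_0 [simp]: "inv_qpoch 0 = 1"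
  by (simp add: inv_qpoch_def qpoch_def)

lemma inv_qpoch_pred: "inv_qpoch (m - 1) = (1 - fps_X ^ nat m) * (inv_qpoch m :: 'a::field fps)"
proof (cases "m > 0")
  case True
  then obtain k where m: "m = int (Suc k)"
    by (metis zero_less_imp_eq_int gr0_implies_Suc)
  let ?u = "1 - fps_X ^ Suc k :: 'a fps"
  have "inv_qpoch m = inv_qpoch (m - 1) * inverse ?u"
    by (simp add: m inv_qpoch_def qpoch_def nat_add_distrib fps_inverse_mult)
  moreover have "inverse ?u * ?u = 1"
    by (rule inverse_mult_eq_1) simp
  ultimately have "inv_qpoch m * ?u = inv_qpoch (m - 1)"
    by (simp only: mult.assoc mult_1_right)
  then show ?thesis by (simp only: m nat_int mult.commute)
qed auto

definition inv_qpoch2 :: "int \<Rightarrow> int \<Rightarrow> 'a::field fps" where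
  "inv_qpoch2 a b = inv_qpoch a * inv_qpoch b"

lemma inv_qpoch2_neg [simp]: "a < 0 \<or> b < 0 \<Longrightarrow> inv_qpoch2 a b = 0"
  by (auto simp: inv_qpoch2_def)

lemma inv_qpoch2_0 [simp]: "inv_qpoch2 0 0 = 1"
  by (simp add: inv_qpoch2_def)

lemma inv_qpoch2_commute: "inv_qpoch2 a b = inv_qpoch2 b a"
  by (simp add: inv_qpoch2_def mult.commute)

lemma inv_qpoch2_diff_left:
  "inv_qpoch2 a b - inv_qpoch2 (a - 1) b = fps_X ^ nat a * inv_qpoch2 a b"
  by (simp add: inv_qpoch2_def inv_qpoch_pred algebra_simps)

lemma inv_qpoch2_diff_right:
  "inv_qpoch2 a b - inv_qpoch2 a (b - 1) = fps_X ^ nat b * inv_qpoch2 a b"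
  by (simp add: inv_qpoch2_def inv_qpoch_pred algebra_simps)

lemma inv_qpoch2_interior:
  "inv_qpoch2 a b - inv_qpoch2 (a - 1) b - inv_qpoch2 a (b - 1) + inv_qpoch2 (a - 1) (b - 1)
     = fps_X ^ nat (a + b) * inv_qpoch2 a b"
proof (cases "a < 0 \<or> b < 0")
  case False
  then show ?thesis
    by (simp add: inv_qpoch2_def inv_qpoch_pred nat_add_distrib power_add algebra_simps)
qed auto

lemma qbinom_eq_qpoch_mult_inv_qpoch2:
  "qbinom (2 * int n) (int n - j) =
     qpoch fps_X fps_X (2 * n) * inv_qpoch2 (int n + j) (int n - j)"
proof (cases "0 \<le> int n - j \<and> 0 \<le> int n + j")
  case True
  then show ?thesis
    by (simp add: qbinom_def inv_qpoch2_def inv_qpoch_def fps_divide_unit qpoch_nth_0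
        fps_inverse_mult nat_mult_distrib algebra_simps)
qed (auto simp: qbinom_def)

section \<open>The reflection sum\<close>

text \<open>The index \<open>r\<close> runs through the infinite dihedral group generated by the reflections in
  \<open>a - b = c + 1\<close> and \<open>b - a = d + 1\<close>. With \<open>s = refl_shift c d r\<close>, the element with index \<open>r\<close>
  sends \<open>(a, b)\<close> to \<open>(a + s, b - s)\<close> if \<open>r\<close> is even and to \<open>(b + s, a - s)\<close> if \<open>r\<close> is odd;
  passing from \<open>r\<close> to \<open>r + 1\<close> amounts to reflecting \<open>(a, b)\<close> first, in one line or the other
  depending on the parity of \<open>r\<close>.\<close>

definition refl_shift :: "nat \<Rightarrow> nat \<Rightarrow> int \<Rightarrow> int" where
  "refl_shift c d r = (int c + 1) * ((r + 1) div 2) + (int d + 1) * (r div 2)"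

definition refl_exponent :: "nat \<Rightarrow> nat \<Rightarrow> int \<Rightarrow> int" where
  "refl_exponent c d r = r * ((int c + int d + 2) * r + (int c - int d)) div 2"

definition refl_term :: "nat \<Rightarrow> nat \<Rightarrow> int \<Rightarrow> int \<Rightarrow> int \<Rightarrow> 'a::field fps" where
  "refl_term c d a b r =
     (let s = refl_shift c d r; w = fps_X ^ nat (refl_exponent c d r)
      in if even r then w * inv_qpoch2 (a + s) (b - s) else - (w * inv_qpoch2 (b + s) (a - s)))"

definition refl_sum :: "nat \<Rightarrow> nat \<Rightarrow> int \<Rightarrow> int \<Rightarrow> 'a::field fps" where
  "refl_sum c d a b = Sum_any (refl_term c d a b)"

lemma refl_shift_0 [simp]: "refl_shift c d 0 = 0"
  by (simp add: refl_shift_def)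

lemma refl_shift_minus: "refl_shift c d (- r) = - refl_shift d c r"
proof -
  have "(- r + 1) div 2 = - (r div 2)" "(- r) div 2 = - ((r + 1) div 2)"
    by presburger+
  then show ?thesis by (simp add: refl_shift_def)
qed

lemma refl_shift_even_Suc: "even r \<Longrightarrow> refl_shift c d (r + 1) = refl_shift c d r + int c + 1"
  by (auto simp: refl_shift_def algebra_simps elim!: evenE)

lemma strict_mono_refl_shift: "strict_mono (refl_shift c d)"
proof (rule strict_monoI)
  fix r r' :: int
  assume "r < r'"
  then have "int c * ((r + 1) div 2) \<le> int c * ((r' + 1) div 2)"
    "int d * (r div 2) \<le> int d * (r' div 2)"
    by (auto intro!: mult_left_mono zdiv_mono1)
  moreover have "(r + 1) div 2 + r div 2 = r" "(r' + 1) div 2 + r' div 2 = r'"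
    by presburger+
  ultimately show "refl_shift c d r < refl_shift c d r'"
    using \<open>r < r'\<close> by (simp add: refl_shift_def algebra_simps)
qed

lemmas refl_shift_le_iff = strict_mono_less_eq [OF strict_mono_refl_shift]
lemmas refl_shift_eq_iff = strict_mono_eq [OF strict_mono_refl_shift]

lemma refl_shift_bounds:
  "r \<ge> 1 \<Longrightarrow> refl_shift c d r \<ge> int c + 1"
  "r \<ge> 2 \<Longrightarrow> refl_shift c d r \<ge> int c + int d + 2"
  "r \<le> -1 \<Longrightarrow> refl_shift c d r \<le> - (int d + 1)"
  "r \<le> -2 \<Longrightarrow> refl_shift c d r \<le> - (int c + int d + 2)"
  using refl_shift_le_iff [of c d 1 r] refl_shift_le_iff [of c d 2 r]
    refl_shift_le_iff [of c d r "-1"] refl_shift_le_iff [of c d r "-2"]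
  by (simp_all add: refl_shift_def [of _ _ 1] refl_shift_def [of _ _ 2]
      refl_shift_def [of _ _ "-1"] refl_shift_def [of _ _ "-2"])

lemma two_mult_refl_exponent:
  "2 * refl_exponent c d r = r * ((int c + int d + 2) * r + (int c - int d))"
  unfolding refl_exponent_def by (rule dvd_mult_div_cancel) auto

lemma refl_exponent_nonneg: "refl_exponent c d r \<ge> 0"
proof -
  have "0 \<le> r * (r + 1)" "0 \<le> r * (r - 1)"
    by (auto simp: zero_le_mult_iff)
  then have "0 \<le> int c * (r * (r + 1)) + int d * (r * (r - 1)) + 2 * r\<^sup>2"
    by simp
  also have "\<dots> = 2 * refl_exponent c d r"
    by (simp add: two_mult_refl_exponent power2_eq_square algebra_simps)
  finally show ?thesis by simp
qed

lemma refl_exponent_minus: "refl_exponent c d (- r) = refl_exponent d c r"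
  by (simp add: refl_exponent_def algebra_simps)

lemma refl_exponent_Suc:
  "refl_exponent c d (r + 1) = refl_exponent c d r + refl_shift c d r + refl_shift c d (r + 1)"
proof -
  have halves: "(r + 1) div 2 = r - r div 2" "(r + 1 + 1) div 2 = r div 2 + 1"
    by presburger+
  have "2 * refl_exponent c d (r + 1) =
      2 * (refl_exponent c d r + refl_shift c d r + refl_shift c d (r + 1))"
    unfolding distrib_left two_mult_refl_exponent refl_shift_def halves
    by (simp add: algebra_simps)
  then show ?thesis by simp
qed

lemma finite_support_refl_term: "finite {r. refl_term c d a b r \<noteq> 0}"
proof (rule finite_subset)
  let ?I = "{- \<bar>a\<bar> - \<bar>b\<bar>..\<bar>a\<bar> + \<bar>b\<bar>}"
  show "{r. refl_term c d a b r \<noteq> 0} \<subseteq> refl_shift c d -` ?I"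
  proof (rule subsetI, rule ccontr)
    fix r assume "r \<notin> refl_shift c d -` ?I"
    then have "a + refl_shift c d r < 0 \<or> b - refl_shift c d r < 0"
      "b + refl_shift c d r < 0 \<or> a - refl_shift c d r < 0"
      by auto
    moreover assume "r \<in> {r. refl_term c d a b r \<noteq> 0}"
    ultimately show False
      by (simp add: refl_term_def Let_def split: if_splits)
  qed
  show "finite (refl_shift c d -` ?I)"
    by (intro finite_vimageI strict_mono_imp_inj_on strict_mono_refl_shift) simp
qed

lemma refl_sum_swap: "refl_sum c d a b = refl_sum d c b a"
  unfolding refl_sum_def
proof (rule Sum_any.reindex_cong)
  show "bij (uminus :: int \<Rightarrow> int)"
    by (rule involuntory_imp_bij) simp
  show "refl_term c d a b \<circ> uminus = refl_term d c b a"
    by (simp add: fun_eq_iff refl_term_def refl_shift_minus refl_exponent_minus Let_def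
        inv_qpoch2_commute)
qed

lemma refl_sum_origin: "refl_sum c d 0 0 = (1 :: 'a::field fps)"
proof -
  have "refl_term c d 0 0 r = (if r = 0 then 1 else 0 :: 'a fps)" for r
  proof (cases "r = 0")
    case False
    then have "refl_shift c d r \<noteq> 0"
      by (metis refl_shift_0 refl_shift_eq_iff)
    with False show ?thesis
      by (auto simp: refl_term_def Let_def neq_iff)
  qed (simp add: refl_term_def refl_exponent_def)
  then show ?thesis by (simp add: refl_sum_def)
qed

lemma refl_sum_outside_quadrant:
  assumes "a < 0 \<or> b < 0" "a - b \<le> int c + 1" "b - a \<le> int d + 1"
  shows "refl_sum c d a b = (0 :: 'a::field fps)"
proof -
  have "refl_term c d a b r = (0 :: 'a fps)" for r
  proof -
    define s where "s = refl_shift c d r"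
    note bounds = refl_shift_bounds [of r c d, folded s_def]
    show ?thesis
    proof (cases "even r")
      case True
      then consider "r = 0" | "r \<ge> 2" | "r \<le> -2" by fastforce
      then have "a + s < 0 \<or> b - s < 0"
        using assms bounds by cases (auto simp: s_def)
      with True show ?thesis by (auto simp: refl_term_def s_def)
    next
      case False
      then have "r \<noteq> 0" by auto
      then consider "r \<ge> 1" | "r \<le> -1" by linarith
      then have "b + s < 0 \<or> a - s < 0"
        using assms bounds by cases auto
      with False show ?thesis by (auto simp: refl_term_def s_def)
    qed
  qed
  then show ?thesis by (simp add: refl_sum_def)
qed

lemma refl_sum_interior:
  "refl_sum c d a b - refl_sum c d (a - 1) b - refl_sum c d a (b - 1) + refl_sum c d (a - 1) (b - 1)
     = fps_X ^ nat (a + b) * refl_sum c d a b" (is "?lhs = _")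
proof -
  let ?T = "refl_term c d :: int \<Rightarrow> int \<Rightarrow> int \<Rightarrow> 'a fps"
  have interior_translate: "w * inv_qpoch2 (x + s) (y - s) - w * inv_qpoch2 (x - 1 + s) (y - s)
      - (w * inv_qpoch2 (x + s) (y - 1 - s) - w * inv_qpoch2 (x - 1 + s) (y - 1 - s))
      = fps_X ^ nat (x + y) * (w * inv_qpoch2 (x + s) (y - s))"
    for w :: "'a fps" and x y s
    using arg_cong [OF inv_qpoch2_interior [of "x + s" "y - s"], of "(*) w"]
    by (simp add: algebra_simps)
  have "?T a b r - ?T (a - 1) b r - (?T a (b - 1) r - ?T (a - 1) (b - 1) r) =
      fps_X ^ nat (a + b) * ?T a b r" for r
  proof (cases "even r")
    case True
    then show ?thesis by (simp add: refl_term_def Let_def interior_translate)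
  next
    case False
    then show ?thesis
      using interior_translate [of "fps_X ^ nat (refl_exponent c d r)" b "refl_shift c d r" a]
      by (simp add: refl_term_def Let_def algebra_simps)
  qed
  then have "fps_X ^ nat (a + b) * refl_sum c d a b =
      Sum_any (\<lambda>r. ?T a b r - ?T (a - 1) b r - (?T a (b - 1) r - ?T (a - 1) (b - 1) r))"
    by (simp add: refl_sum_def Sum_any_right_distrib finite_support_refl_term)
  also have "\<dots> = ?lhs"
    by (simp only: Sum_any_diff finite_support_diff finite_support_refl_term refl_sum_def)
      (simp only: diff_diff_eq2 diff_add_eq)
  finally show ?thesis ..
qed

lemma refl_term_upper_boundary:
  assumes "a = b + int c + 1" "even r"
  shows "refl_term c d a b (r + 1) - refl_term c d (a - 1) b (r + 1) =
    - (refl_term c d a b r - refl_term c d (a - 1) b r)"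
proof -
  define s where "s = refl_shift c d r"
  let ?X = "\<lambda>m. fps_X ^ nat m :: 'a fps"
  let ?e = "refl_exponent c d r" and ?e' = "refl_exponent c d (r + 1)"
  have shift_Suc: "refl_shift c d (r + 1) = a - b + s"
    using assms by (simp add: s_def refl_shift_even_Suc)
  have exponents: "?e + (a + s) = ?e' + (b - s)"
    by (simp add: refl_exponent_Suc shift_Suc flip: s_def)
  have term_even: "refl_term c d x b r = ?X ?e * inv_qpoch2 (x + s) (b - s)" for x
    using assms(2) by (simp add: refl_term_def Let_def s_def)
  have term_odd: "refl_term c d x b (r + 1) = - (?X ?e' * inv_qpoch2 (a + s) (b - s - (a - x)))"
    for x
    using assms(2) unfolding refl_term_def Let_def shift_Suc by (simp add: algebra_simps)
  have "refl_term c d a b r - refl_term c d (a - 1) b r =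
      ?X ?e * (inv_qpoch2 (a + s) (b - s) - inv_qpoch2 (a + s - 1) (b - s))"
    by (simp add: term_even algebra_simps)
  also have "\<dots> = ?X ?e * ?X (a + s) * inv_qpoch2 (a + s) (b - s)"
    by (simp only: inv_qpoch2_diff_left mult.assoc)
  also have "\<dots> = ?X ?e' * ?X (b - s) * inv_qpoch2 (a + s) (b - s)"
  proof (cases "a + s < 0 \<or> b - s < 0")
    case False
    then show ?thesis
      by (simp add: exponents refl_exponent_nonneg flip: power_add nat_add_distrib)
  qed simp
  also have "\<dots> = ?X ?e' * (inv_qpoch2 (a + s) (b - s) - inv_qpoch2 (a + s) (b - s - 1))"
    by (simp only: inv_qpoch2_diff_right mult.assoc)
  also have "\<dots> = - (refl_term c d a b (r + 1) - refl_term c d (a - 1) b (r + 1))"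
    by (simp add: term_odd right_diff_distrib)
  finally show ?thesis by simp
qed

lemma refl_sum_upper_boundary:
  assumes "a = b + int c + 1"
  shows "refl_sum c d a b = (refl_sum c d (a - 1) b :: 'a::field_char_0 fps)"
proof -
  define D :: "int \<Rightarrow> 'a fps" where "D r = refl_term c d a b r - refl_term c d (a - 1) b r" for r
  have D_Suc: "D (r + 1) = - D r" if "even r" for r
    using refl_term_upper_boundary [OF assms that] by (simp add: D_def)
  have "Sum_any D = 0"
  proof (rule Sum_any_eq_0_involution)
    show "D (if even r then r + 1 else r - 1) = - D r" for r
      using D_Suc [of r] D_Suc [of "r - 1"] by auto
  qed auto
  then show ?thesis
    by (simp add: D_def Sum_any_diff finite_support_refl_term refl_sum_def)
qed

lemma strip_recurrence_refl_sum:
  "strip_recurrence c d (refl_sum c d :: int \<Rightarrow> int \<Rightarrow> 'a::field_char_0 fps)"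
proof
  fix a b
  assume "b = a + int d + 1"
  then show "(refl_sum c d a b :: 'a fps) = refl_sum c d a (b - 1)"
    by (simp only: refl_sum_swap [of c d] refl_sum_upper_boundary)
qed (simp_all add: refl_sum_origin refl_sum_outside_quadrant refl_sum_upper_boundary
    refl_sum_interior)

section \<open>Generating functions\<close>

definition weight_gf :: "('b \<Rightarrow> nat) \<Rightarrow> 'b set \<Rightarrow> 'a::semiring_1 fps" where
  "weight_gf w A = Abs_fps (\<lambda>k. of_nat (card {x \<in> A. w x = k}))"

lemma weight_gf_empty [simp]: "weight_gf w {} = 0"
  by (simp add: weight_gf_def fps_eq_iff)

lemma weight_gf_Un_Int:
  assumes "\<And>k. finite {x \<in> A. w x = k}" "\<And>k. finite {x \<in> B. w x = k}"
  shows "weight_gf w (A \<union> B) + weight_gf w (A \<inter> B) = weight_gf w A + weight_gf w B"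
proof (rule fps_ext)
  fix k
  have "{x \<in> A \<union> B. w x = k} = {x \<in> A. w x = k} \<union> {x \<in> B. w x = k}"
    "{x \<in> A \<inter> B. w x = k} = {x \<in> A. w x = k} \<inter> {x \<in> B. w x = k}"
    by auto
  then show "fps_nth (weight_gf w (A \<union> B) + weight_gf w (A \<inter> B)) k =
      fps_nth (weight_gf w A + weight_gf w B) k"
    using card_Un_Int [OF assms] by (simp add: weight_gf_def flip: of_nat_add)
qed

lemma weight_gf_image:
  assumes "inj_on f A" "\<And>x. x \<in> A \<Longrightarrow> w (f x) = v x + m"
  shows "weight_gf w (f ` A) = fps_X ^ m * weight_gf v A"
proof (rule fps_ext)
  fix k
  have "{y \<in> f ` A. w y = k} = f ` {x \<in> A. v x + m = k}"
    using assms(2) by auto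
  moreover have "inj_on f {x \<in> A. v x + m = k}"
    using assms(1) by (rule inj_on_subset) auto
  ultimately have "card {y \<in> f ` A. w y = k} = card {x \<in> A. v x + m = k}"
    by (simp add: card_image)
  moreover have "{x \<in> A. v x + m = k} = (if k < m then {} else {x \<in> A. v x = k - m})"
    by auto
  ultimately show "fps_nth (weight_gf w (f ` A)) k = fps_nth (fps_X ^ m * weight_gf v A) k"
    by (simp add: weight_gf_def fps_X_power_mult_nth)
qed

section \<open>Adding and removing the first column of a partition\<close>

definition add_column :: "nat \<Rightarrow> nat list \<Rightarrow> nat list" where
  "add_column a xs = map Suc xs @ replicate (a - length xs) 1"

definition del_column :: "nat list \<Rightarrow> nat list" where
  "del_column xs = map (\<lambda>x. x - 1) (filter (\<lambda>x. 1 < x) xs)"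

lemma length_add_column: "length xs \<le> a \<Longrightarrow> length (add_column a xs) = a"
  by (simp add: add_column_def)

lemma length_del_column: "length (del_column xs) \<le> length xs"
  by (simp add: del_column_def)

lemma sum_list_add_column: "length xs \<le> a \<Longrightarrow> sum_list (add_column a xs) = sum_list xs + a"
  using sum_list_Suc [of id xs] by (simp add: add_column_def sum_list_replicate)

lemma part_add_column:
  "length xs \<le> a \<Longrightarrow> part (add_column a xs) j = (if 1 \<le> j \<and> j \<le> a then Suc (part xs j) else 0)"
  by (auto simp: part_def add_column_def nth_append)

lemma int_partition_add_column: "int_partition xs \<Longrightarrow> int_partition (add_column a xs)"
  by (auto simp: int_partition_def add_column_def sorted_wrt_append sorted_wrt_map
      sorted_wrt_iff_nth_less [of _ "replicate _ _"])

lemma int_partition_del_column: "int_partition xs \<Longrightarrow> int_partition (del_column xs)"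
  by (auto simp: int_partition_def del_column_def sorted_wrt_map
      intro!: sorted_wrt_filter elim!: sorted_wrt_mono_rel [rotated])

lemma del_add_column: "int_partition xs \<Longrightarrow> del_column (add_column a xs) = xs"
  by (simp add: int_partition_def del_column_def add_column_def filter_map comp_def)

lemma add_del_column: "int_partition xs \<Longrightarrow> add_column (length xs) (del_column xs) = xs"
proof (induction xs)
  case (Cons x xs)
  then have IH: "add_column (length xs) (del_column xs) = xs"
    by (simp add: int_partition_def)
  show ?case
  proof (cases "x = 1")
    case True
    then have "\<forall>y\<in>set xs. y = 1"
      using Cons.prems by (auto simp: int_partition_def le_Suc_eq)
    then have "del_column (x # xs) = []" "xs = replicate (length xs) 1"
      using True by (auto simp: del_column_def filter_empty_conv intro: replicate_eqI)
    with True show ?thesis by (simp add: add_column_def)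
  next
    case False
    then have "x > 1"
      using Cons.prems by (auto simp: int_partition_def)
    with IH show ?thesis by (simp add: add_column_def del_column_def)
  qed
qed (simp add: add_column_def del_column_def)

section \<open>Cylindric partitions with bounded numbers of parts\<close>

lemma part_eq_0_iff: "int_partition xs \<Longrightarrow> j \<ge> 1 \<Longrightarrow> part xs j = 0 \<longleftrightarrow> length xs < j"
  by (auto simp: part_def int_partition_def)

lemma cylindric_partition_swap:
  "cylindric_partition (c, d) (xs, ys) \<longleftrightarrow> cylindric_partition (d, c) (ys, xs)"
  by (auto simp: cylindric_partition_def)

lemma cylindric_partition_length_le:
  assumes "cylindric_partition (c, d) (xs, ys)"
  shows "length xs \<le> length ys + c"
proof -
  let ?j = "length ys + 1"
  have "part xs (?j + c) \<le> part ys ?j"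
    using assms unfolding cylindric_partition_def by auto
  also have "part ys ?j = 0"
    by (simp add: part_def)
  finally have "length xs < ?j + c"
    using assms by (subst part_eq_0_iff [symmetric]) (auto simp: cylindric_partition_def)
  then show ?thesis by simp
qed

lemma cylindric_partition_add_column:
  assumes "int_partition xs" "int_partition ys" "length xs \<le> a" "length ys \<le> b"
    and "a \<le> b + c" "b \<le> a + d"
  shows "cylindric_partition (c, d) (add_column a xs, add_column b ys) \<longleftrightarrow>
    cylindric_partition (c, d) (xs, ys)"
proof -
  have part_le_iff: "part (add_column l us) j \<ge> part (add_column m vs) (j + k) \<longleftrightarrow>
      part us j \<ge> part vs (j + k)"
    if "length us \<le> l" "length vs \<le> m" "m \<le> l + k" "j \<ge> 1" for us vs l m k j
    using that by (auto simp: part_add_column) (auto simp: part_def)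
  then show ?thesis
    using assms by (simp add: cylindric_partition_def int_partition_add_column)
qed

definition cp_box :: "nat \<times> nat \<Rightarrow> int \<Rightarrow> int \<Rightarrow> (nat list \<times> nat list) set" where
  "cp_box c a b =
     {(xs, ys). cylindric_partition c (xs, ys) \<and> int (length xs) \<le> a \<and> int (length ys) \<le> b}"

definition cp_exact :: "nat \<times> nat \<Rightarrow> int \<Rightarrow> int \<Rightarrow> (nat list \<times> nat list) set" where
  "cp_exact c a b =
     {(xs, ys). cylindric_partition c (xs, ys) \<and> int (length xs) = a \<and> int (length ys) = b}"

definition cp_gf :: "nat \<times> nat \<Rightarrow> int \<Rightarrow> int \<Rightarrow> rat fps" where
  "cp_gf c a b = weight_gf cp_size (cp_box c a b)"

lemma CP_eq_cp_gf: "CP c n = cp_gf c (int n) (int n)"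
  unfolding CP_def cp_gf_def weight_gf_def
  by (intro arg_cong [of _ _ Abs_fps] ext arg_cong [of _ _ of_nat] arg_cong [of _ _ card])
    (auto simp: cp_set_def cp_box_def)

lemma finite_cp_box_size: "finite {p \<in> cp_box c a b. cp_size p = k}"
  by (rule finite_subset [OF _ finite_cp_set [of c "nat (max a b)" k]])
    (auto simp: cp_box_def cp_set_def)

lemma cp_box_Int: "cp_box c a b \<inter> cp_box c a' b' = cp_box c (min a a') (min b b')"
  by (auto simp: cp_box_def)

lemma cp_box_swap: "cp_box (c, d) a b = prod.swap ` cp_box (d, c) b a"
  by (auto simp: cp_box_def cylindric_partition_swap [of c d] image_iff)

lemma cp_gf_swap: "cp_gf (c, d) a b = cp_gf (d, c) b a"
proof -
  have "cp_gf (c, d) a b = fps_X ^ 0 * cp_gf (d, c) b a"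
    unfolding cp_gf_def cp_box_swap [of c d]
    by (rule weight_gf_image) (auto simp: cp_size_def)
  then show ?thesis by simp
qed

lemma cp_exact_eq_add_column_image:
  assumes "a \<le> b + c" "b \<le> a + d"
  shows "cp_exact (c, d) (int a) (int b) =
    map_prod (add_column a) (add_column b) ` cp_box (c, d) (int a) (int b)"
proof (intro equalityI subsetI)
  fix p assume "p \<in> cp_exact (c, d) (int a) (int b)"
  then obtain xs ys where components: "p = (xs, ys)" "cylindric_partition (c, d) (xs, ys)"
    "length xs = a" "length ys = b" "int_partition xs" "int_partition ys"
    by (auto simp: cp_exact_def cylindric_partition_def)
  let ?us = "del_column xs" and ?vs = "del_column ys"
  have "p = map_prod (add_column a) (add_column b) (?us, ?vs)"
    using components add_del_column by auto
  moreover have "(?us, ?vs) \<in> cp_box (c, d) (int a) (int b)"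
    using cylindric_partition_add_column [of ?us ?vs a b c d] components assms
      length_del_column [of xs] length_del_column [of ys]
    by (auto simp: cp_box_def int_partition_del_column add_del_column)
  ultimately show "p \<in> map_prod (add_column a) (add_column b) ` cp_box (c, d) (int a) (int b)"
    by (rule image_eqI)
next
  fix p assume "p \<in> map_prod (add_column a) (add_column b) ` cp_box (c, d) (int a) (int b)"
  then obtain xs ys where components: "p = (add_column a xs, add_column b ys)"
    "cylindric_partition (c, d) (xs, ys)"
    "length xs \<le> a" "length ys \<le> b" "int_partition xs" "int_partition ys"
    by (auto simp: cp_box_def cylindric_partition_def)
  then show "p \<in> cp_exact (c, d) (int a) (int b)"
    using assms by (simp add: cp_exact_def cylindric_partition_add_column length_add_column)
qed

lemma weight_gf_cp_exact:
  assumes "0 \<le> a" "0 \<le> b" "a - b \<le> int c" "b - a \<le> int d"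
  shows "weight_gf cp_size (cp_exact (c, d) a b) = fps_X ^ nat (a + b) * cp_gf (c, d) a b"
proof -
  obtain k l where ab_eq: "a = int k" "b = int l"
    using assms by (metis nonneg_int_cases)
  let ?add = "map_prod (add_column k) (add_column l)"
  have "inj_on ?add (cp_box (c, d) a b)"
    by (rule inj_on_inverseI [of _ "map_prod del_column del_column"])
      (auto simp: cp_box_def cylindric_partition_def del_add_column)
  moreover have "cp_size (?add p) = cp_size p + nat (a + b)" if "p \<in> cp_box (c, d) a b" for p
    using that by (auto simp: cp_box_def cp_size_def sum_list_add_column ab_eq)
  ultimately have "weight_gf cp_size (?add ` cp_box (c, d) a b) =
      fps_X ^ nat (a + b) * cp_gf (c, d) a b"
    unfolding cp_gf_def by (rule weight_gf_image)
  moreover have "cp_exact (c, d) a b = ?add ` cp_box (c, d) a b"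
    using assms unfolding ab_eq by (intro cp_exact_eq_add_column_image) auto
  ultimately show ?thesis by simp
qed

lemma cp_gf_inclusion_exclusion:
  "cp_gf c a b - cp_gf c (a - 1) b - cp_gf c a (b - 1) + cp_gf c (a - 1) (b - 1) =
     weight_gf cp_size (cp_exact c a b)"
proof -
  let ?A = "cp_box c (a - 1) b" and ?B = "cp_box c a (b - 1)" and ?E = "cp_exact c a b"
  let ?gf = "weight_gf cp_size :: _ \<Rightarrow> rat fps"
  have box: "cp_box c a b = (?A \<union> ?B) \<union> ?E" and disjoint: "(?A \<union> ?B) \<inter> ?E = {}"
    by (auto simp: cp_box_def cp_exact_def)
  have finite_Un: "finite {p \<in> ?A \<union> ?B. cp_size p = k}" for k
    using finite_cp_box_size [of c a b k] by (rule rev_finite_subset) (auto simp: box)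
  have finite_E: "finite {p \<in> ?E. cp_size p = k}" for k
    using finite_cp_box_size [of c a b k] by (rule rev_finite_subset) (auto simp: box)
  have "cp_gf c a b = ?gf (?A \<union> ?B) + ?gf ?E"
    using weight_gf_Un_Int [OF finite_Un finite_E] by (simp add: cp_gf_def box disjoint)
  moreover have "?gf (?A \<union> ?B) + cp_gf c (a - 1) (b - 1) = cp_gf c (a - 1) b + cp_gf c a (b - 1)"
    using weight_gf_Un_Int [OF finite_cp_box_size finite_cp_box_size, of c "a - 1" b c a "b - 1"]
    by (simp add: cp_gf_def cp_box_Int)
  ultimately show ?thesis by (simp add: algebra_simps)
qed

lemma cp_gf_upper_boundary:
  assumes "a = b + int c + 1"
  shows "cp_gf (c, d) a b = cp_gf (c, d) (a - 1) b"
proof -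
  have "cp_box (c, d) a b = cp_box (c, d) (a - 1) b"
    using assms cylindric_partition_length_le by (fastforce simp: cp_box_def)
  then show ?thesis by (simp add: cp_gf_def)
qed

lemma strip_recurrence_cp_gf: "strip_recurrence c d (cp_gf (c, d))"
proof
  show "cp_gf (c, d) 0 0 = 1"
    using CP_eq_cp_gf [of "(c, d)" 0] CP_0 by simp
next
  fix a b
  assume "b = a + int d + 1"
  then show "cp_gf (c, d) a b = cp_gf (c, d) a (b - 1)"
    by (simp only: cp_gf_swap [of c d] cp_gf_upper_boundary)
next
  fix a b :: int
  assume "a < 0 \<or> b < 0"
  then have "cp_box (c, d) a b = {}"
    by (auto simp: cp_box_def)
  then show "cp_gf (c, d) a b = 0"
    by (simp add: cp_gf_def)
qed (simp_all add: cp_gf_upper_boundary cp_gf_inclusion_exclusion weight_gf_cp_exact)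

section \<open>The bilateral sum\<close>

lemma lower_index_eq_refl_shift:
  "\<lfloor>of_nat n - of_int (int c + int d + 2) * of_int r / 2
      + of_int (int c - int d) * (((-1) powi r - 1) / 4) :: rat\<rfloor> = int n - refl_shift c d r"
proof -
  have "(of_nat n - of_int (int c + int d + 2) * of_int r / 2
      + of_int (int c - int d) * (((-1) powi r - 1) / 4) :: rat) =
      of_int (int n - refl_shift c d r)"
  proof (cases "even r")
    case True
    then show ?thesis
      by (auto simp: refl_shift_def field_simps elim!: evenE)
  next
    case False
    then show ?thesis
      by (auto simp: refl_shift_def power_int_minus_left field_simps elim!: oddE)
  qed
  then show ?thesis by (simp only: floor_of_int)
qed

theorem CP_eq_bilateral_sum:
  "CP (c, d) n = 1 / qpoch fps_X fps_X (2 * n) *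
    (\<Sum>\<^sub>\<infinity>r::int\<in>UNIV. fps_const ((-1) powi r) *
       fps_X ^ nat (r * ((int c + int d + 2) * r + (int c - int d)) div 2) *
       qbinom (2 * int n)
         \<lfloor>of_nat n - of_int (int c + int d + 2) * of_int r / 2
           + of_int (int c - int d) * (((-1) powi r - 1) / 4) :: rat\<rfloor>)"
  (is "_ = 1 / ?P * infsum ?g UNIV")
proof -
  let ?T = "refl_term c d (int n) (int n) :: int \<Rightarrow> rat fps"
  have summand: "?g r = ?P * ?T r" for r
    unfolding lower_index_eq_refl_shift qbinom_eq_qpoch_mult_inv_qpoch2
    by (simp add: refl_term_def refl_exponent_def power_int_minus_left Let_def flip: fps_const_neg)
  have "finite {r. ?P * ?T r \<noteq> 0}"
    using finite_support_refl_term by (rule rev_finite_subset) auto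
  then have "infsum ?g UNIV = Sum_any (\<lambda>r. ?P * ?T r)"
    unfolding summand by (rule infsum_eq_Sum_any)
  also have "\<dots> = ?P * refl_sum c d (int n) (int n)"
    by (simp only: refl_sum_def Sum_any_right_distrib finite_support_refl_term)
  also have "1 / ?P * \<dots> = refl_sum c d (int n) (int n)"
    by (simp add: fps_divide_unit qpoch_nth_0 inverse_mult_eq_1 flip: mult.assoc)
  also have "\<dots> = CP (c, d) n"
    unfolding CP_eq_cp_gf
    by (rule strip_recurrence_unique [OF strip_recurrence_refl_sum strip_recurrence_cp_gf]) auto
  finally show ?thesis ..
qed

theorem theorem1p1:
  fixes n :: nat
  shows "CP (2, 1) n = 1 / qpoch fps_X fps_X (2 * n) *
           (\<Sum>\<^sub>\<infinity>r::int\<in>UNIV. fps_const ((-1) powi r) * fps_X ^ nat (r * (5 * r + 1) div 2) *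
              qbinom (2 * int n)
                \<lfloor>of_nat n - 5 * of_int r / 2 + ((-1) powi r - 1) / 4 :: rat\<rfloor>) \<and>
         CP (3, 0) n = 1 / qpoch fps_X fps_X (2 * n) *
           (\<Sum>\<^sub>\<infinity>r::int\<in>UNIV. fps_const ((-1) powi r) * fps_X ^ nat (r * (5 * r + 3) div 2) *
              qbinom (2 * int n)
                \<lfloor>of_nat n - 5 * of_int r / 2 + 3 * (((-1) powi r - 1) / 4) :: rat\<rfloor>)"
  using CP_eq_bilateral_sum [of 2 1 n] CP_eq_bilateral_sum [of 3 0 n] by simp

end
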